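(* Let $\lambda$ be a real number with $\lambda>-1$, $\lambda\neq0$, and let $x$ be a real number (or an indeterminate). For every integer $n\ge0$, \[ \mathrm{Bel}_{n+1,\lambda}(x)=x\,\frac{\log(1+\lambda)}{\lambda}\sum_{k=0}^{n}\binom{n}{k}\mathrm{Bel}_{k,\lambda}(x)\,(1-\lambda\mid\lambda)_{n-k}. \]
   Context: The degenerate Bell polynomials $\mathrm{Bel}_{n,\lambda}(x)$ are defined by \[ (1+\lambda)^{\frac{x}{\lambda}\left((1+\lambda t)^{1/\lambda}-1\right)}=\exp\!\Big(\tfrac{x}{\lambda}\log(1+\lambda)\big((1+\lambda t)^{1/\lambda}-1\big)\Big)=\sum_{n=0}^{\infty}\mathrm{Bel}_{n,\lambda}(x)\frac{t^{n}}{n!}, \] with $(1+\lambda t)^{1/\lambda}=\exp(\tfrac1\lambda\log(1+\lambda t))$. For a number $a$, $(a\mid\lambda)_0=1$ and $(a\mid\lambda)_n=a(a-\lambda)(a-2\lambda)\cdots(a-(n-1)\lambda)$ for $n\ge1$. (The paper writes the factor $\frac{\log(1+\lambda)}{\lambda}$ as $\log(1+\lambda)^{1/\lambda}$, meaning $\log\big((1+\lambda)^{1/\lambda}\big)$.) *)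

theory Defs
  imports
    "HOL-Computational_Algebra.Computational_Algebra"
    Complex_Main
begin

text \<open>The formal power series in \<open>t\<close> of \<open>(1 + \<lambda> t)\<^sup>1\<^sup>/\<^sup>\<lambda> = exp ((1/\<lambda>) log (1 + \<lambda> t))\<close>;
  here \<open>fps_ln 1\<close> is the series of \<open>log (1 + t)\<close>.\<close>

definition degenerate_exp_fps :: "real \<Rightarrow> real fps" where
  "degenerate_exp_fps lam = fps_exp (1 / lam) oo (fps_ln 1 oo (fps_const lam * fps_X))"

text \<open>The exponent \<open>(1/\<lambda>) log (1 + \<lambda>) ((1 + \<lambda> t)\<^sup>1\<^sup>/\<^sup>\<lambda> - 1)\<close>, without the factor \<open>x\<close>.
  Its constant coefficient is 0.\<close>

definition degenerate_bell_exponent :: "real \<Rightarrow> real fps" where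
  "degenerate_bell_exponent lam = fps_const (ln (1 + lam) / lam) * (degenerate_exp_fps lam - 1)"

text \<open>The generating function over the ring of real polynomials in an indeterminate \<open>x\<close>.
  The left factor is \<open>exp (x s) = (\<Sum>k. x\<^sup>k / k! s\<^sup>k)\<close> as a series in \<open>s\<close>; \<open>fps_exp\<close> is
  not used because its coefficient type must have inverses. For \<open>s\<close> one substitutes the exponent, with its real
  coefficients read as constant polynomials.\<close>

definition degenerate_bell_gf :: "real \<Rightarrow> real poly fps" where
  "degenerate_bell_gf lam =
     Abs_fps (\<lambda>k. monom (1 / fact k) k) oo
     Abs_fps (\<lambda>n. [:fps_nth (degenerate_bell_exponent lam) n:])"

definition degenerate_bell :: "nat \<Rightarrow> real \<Rightarrow> real poly" where
  "degenerate_bell n lam = smult (fact n) (fps_nth (degenerate_bell_gf lam) n)"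

definition gen_falling :: "real \<Rightarrow> real \<Rightarrow> nat \<Rightarrow> real" where
  "gen_falling a lam n = (\<Prod>i<n. a - of_nat i * lam)"

lemma Abs_fps_const_poly_power:
  fixes h :: "real fps"
  shows "Abs_fps (\<lambda>n. [:fps_nth h n:]) ^ i = Abs_fps (\<lambda>n. [:fps_nth (h ^ i) n:])"
proof (induction i)
  case 0
  show ?case by (simp add: fps_eq_iff one_pCons)
next
  case (Suc i)
  have sum_pCons: "(\<Sum>j\<in>A. [:f j:]) = [:\<Sum>j\<in>A. f j:]" for A :: "nat set" and f :: "nat \<Rightarrow> real"
    by (induction A rule: infinite_finite_induct) auto
  show ?case
    by (simp add: Suc fps_eq_iff fps_mult_nth sum_pCons mult.commute)
qed

text \<open>For a real number \<open>x\<close>, the values of the polynomials have the expected generating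
  function with real coefficients.\<close>

lemma poly_degenerate_bell_gf:
  "Abs_fps (\<lambda>n. poly (degenerate_bell n lam) x / fact n) =
     fps_exp x oo (fps_const (ln (1 + lam) / lam) * (degenerate_exp_fps lam - 1))"
  unfolding degenerate_bell_def degenerate_bell_gf_def degenerate_bell_exponent_def[symmetric]
  by (simp add: fps_eq_iff fps_compose_nth Abs_fps_const_poly_power poly_sum poly_monom mult.commute)

end

theory Submission
  imports Defs
begin

text \<open>Write \<open>E\<close> for the series of \<open>(1 + \<lambda> t)\<^sup>1\<^sup>/\<^sup>\<lambda>\<close>. It satisfies \<open>(1 + \<lambda> t) E' = E\<close>, so the
  coefficients of \<open>E'\<close> are \<open>(1 - \<lambda> | \<lambda>)\<^sub>n / n!\<close>. Differentiating the generating function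
  \<open>G = exp (x c (E - 1))\<close>, where \<open>c = log (1 + \<lambda>) / \<lambda>\<close>, gives \<open>G' = x c E' G\<close>, and the
  recurrence is the comparison of coefficients.\<close>

lemma gen_falling_0 [simp]: "gen_falling a lam 0 = 1"
  by (simp add: gen_falling_def)

lemma gen_falling_Suc: "gen_falling a lam (Suc n) = gen_falling a lam n * (a - of_nat n * lam)"
  by (simp add: gen_falling_def)

text \<open>Splits off the first factor rather than the last. At \<open>a = 1\<close> that factor
  disappears, which is how the parameter \<open>1 - lam\<close> of the recurrence arises.\<close>

lemma gen_falling_Suc_shift: "gen_falling a lam (Suc n) = a * gen_falling (a - lam) lam n"
  unfolding gen_falling_def by (subst prod.lessThan_Suc_shift) (simp add: algebra_simps)

lemma degenerate_exp_fps_nth_0 [simp]: "fps_nth (degenerate_exp_fps lam) 0 = 1"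
  by (simp add: degenerate_exp_fps_def)

text \<open>By the chain rule, the outer exponential contributes the factor \<open>1 / lam\<close>
  and the inner logarithm \<open>lam / (1 + lam * t)\<close>; the constants cancel.\<close>

lemma degenerate_exp_fps_ODE:
  assumes "lam \<noteq> 0"
  shows "(1 + fps_const lam * fps_X) * fps_deriv (degenerate_exp_fps lam) = degenerate_exp_fps lam"
proof -
  define X' :: "real fps" where "X' = fps_const lam * fps_X"
  have X'0: "fps_nth X' 0 = 0"
    by (simp add: X'_def)
  have "inverse (1 + fps_X) * (1 + fps_X) = (1 :: real fps)"
    by (rule inverse_mult_eq_1) simp
  \<comment> \<open>Substituting a series with zero constant term respects sums and products, so it
    carries the inverse of \<open>1 + t\<close> to that of \<open>1 + lam * t\<close>.\<close>
  then have "(inverse (1 + fps_X) * (1 + fps_X)) oo X' = 1 oo X'"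
    by simp
  then have inv: "(inverse (1 + fps_X) oo X') * (1 + X') = 1"
    by (simp add: fps_compose_mult_distrib[OF X'0] fps_compose_add_distrib X'0)
  have "fps_deriv (fps_ln 1 oo X') = (inverse (1 + fps_X) oo X') * fps_const lam"
    unfolding fps_compose_deriv[OF X'0] fps_ln_deriv by (simp add: X'_def)
  then have "fps_deriv (degenerate_exp_fps lam) =
      fps_const (1 / lam) * degenerate_exp_fps lam * ((inverse (1 + fps_X) oo X') * fps_const lam)"
    by (simp add: degenerate_exp_fps_def X'_def[symmetric] fps_compose_deriv X'0
        fps_const_mult_apply_left[symmetric] fps_compose_mult_distrib)
  then have "(1 + X') * fps_deriv (degenerate_exp_fps lam) =
      (fps_const (1 / lam) * fps_const lam) * ((inverse (1 + fps_X) oo X') * (1 + X')) * degenerate_exp_fps lam"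
    by (simp only: mult_ac)
  also have "\<dots> = degenerate_exp_fps lam"
    using assms by (simp add: inv)
  finally show ?thesis
    by (simp add: X'_def)
qed

lemma degenerate_exp_fps_nth:
  assumes "lam \<noteq> 0"
  shows "fps_nth (degenerate_exp_fps lam) n = gen_falling 1 lam n / fact n"
proof (induction n)
  case 0
  show ?case by simp
next
  case (Suc n)
  have "fps_nth ((1 + fps_const lam * fps_X) * fps_deriv (degenerate_exp_fps lam)) n
      = fps_nth (degenerate_exp_fps lam) n"
    by (simp only: degenerate_exp_fps_ODE[OF assms])
  then have "of_nat (Suc n) * fps_nth (degenerate_exp_fps lam) (Suc n)
      = (1 - of_nat n * lam) * fps_nth (degenerate_exp_fps lam) n"
    \<comment> \<open>Multiplication by \<open>fps_X\<close> shifts the index; at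
      \<open>n = 0\<close> the shifted term is 0.\<close>
    by (cases n) (simp_all add: algebra_simps)
  then show ?case
    by (simp add: Suc gen_falling_Suc field_simps del: of_nat_Suc)
qed

lemma degenerate_exp_fps_deriv_nth:
  assumes "lam \<noteq> 0"
  shows "fps_nth (fps_deriv (degenerate_exp_fps lam)) n = gen_falling (1 - lam) lam n / fact n"
  using degenerate_exp_fps_nth[OF assms, of "Suc n"]
  by (simp add: gen_falling_Suc_shift field_simps del: of_nat_Suc)

text \<open>At a real argument the generating function has coefficients in a field, so
  \<open>fps_exp\<close> and its derivative are available.\<close>

lemma poly_degenerate_bell_Suc:
  assumes "lam \<noteq> 0"
  shows "poly (degenerate_bell (Suc n) lam) x =
    x * (ln (1 + lam) / lam) *
      (\<Sum>k=0..n. of_nat (n choose k) * poly (degenerate_bell k lam) x * gen_falling (1 - lam) lam (n - k))"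
proof -
  define c where "c = ln (1 + lam) / lam"
  define E where "E = degenerate_exp_fps lam"
  define G where "G = Abs_fps (\<lambda>n. poly (degenerate_bell n lam) x / fact n)"
  have G: "G = fps_exp x oo (fps_const c * (E - 1))"
    by (simp add: G_def c_def E_def poly_degenerate_bell_gf)
  have u0: "fps_nth (fps_const c * (E - 1)) 0 = 0"
    by (simp add: E_def)
  have "fps_deriv G = fps_const x * G * (fps_const c * fps_deriv E)"
    by (simp add: G fps_compose_deriv[OF u0] fps_compose_mult_distrib[OF u0])
  then have "fps_deriv G = fps_const (x * c) * (G * fps_deriv E)"
    by (simp add: mult_ac flip: fps_const_mult)
  then have "fps_nth (fps_deriv G) n = x * c * (\<Sum>k=0..n. fps_nth G k * fps_nth (fps_deriv E) (n - k))"
    by (simp only: fps_mult_left_const_nth fps_mult_nth[of G])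
  moreover have "fps_nth (fps_deriv G) n = poly (degenerate_bell (Suc n) lam) x / fact n"
    by (simp add: G_def field_simps del: of_nat_Suc)
  ultimately have "poly (degenerate_bell (Suc n) lam) x =
      x * c * (\<Sum>k=0..n. fact n * (fps_nth G k * fps_nth (fps_deriv E) (n - k)))"
    unfolding sum_distrib_left[symmetric] by (simp add: divide_eq_eq mult_ac del: fps_deriv_nth)
  \<comment> \<open>The factor \<open>fact n\<close> meets the denominators \<open>fact k\<close>
    and \<open>fact (n - k)\<close> of the two series and forms the binomial coefficient.\<close>
  also have "(\<Sum>k=0..n. fact n * (fps_nth G k * fps_nth (fps_deriv E) (n - k))) =
      (\<Sum>k=0..n. of_nat (n choose k) * poly (degenerate_bell k lam) x * gen_falling (1 - lam) lam (n - k))"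
    unfolding E_def degenerate_exp_fps_deriv_nth[OF assms]
    by (intro sum.cong refl) (simp add: G_def binomial_fact)
  finally show ?thesis
    by (simp only: c_def)
qed

theorem theorem5:
  fixes lam x :: real and n :: nat
  assumes "lam > -1" and "lam \<noteq> 0"
  shows "degenerate_bell (n + 1) lam =
           [:0, 1:] * smult (ln (1 + lam) / lam)
             (\<Sum>k=0..n. of_nat (n choose k) * degenerate_bell k lam * [:gen_falling (1 - lam) lam (n - k):])
       \<and> poly (degenerate_bell (n + 1) lam) x =
           x * (ln (1 + lam) / lam) *
             (\<Sum>k=0..n. of_nat (n choose k) * poly (degenerate_bell k lam) x * gen_falling (1 - lam) lam (n - k))"
proof
  show "poly (degenerate_bell (n + 1) lam) x =
      x * (ln (1 + lam) / lam) *
        (\<Sum>k=0..n. of_nat (n choose k) * poly (degenerate_bell k lam) x * gen_falling (1 - lam) lam (n - k))"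
    using poly_degenerate_bell_Suc[OF assms(2)] by simp
  show "degenerate_bell (n + 1) lam =
      [:0, 1:] * smult (ln (1 + lam) / lam)
        (\<Sum>k=0..n. of_nat (n choose k) * degenerate_bell k lam * [:gen_falling (1 - lam) lam (n - k):])"
    (is "?p = ?q")
  proof -
    \<comment> \<open>Real polynomials that agree at every real point are equal, so the pointwise
      recurrence lifts to the indeterminate.\<close>
    have "poly ?p y = poly ?q y" for y
      using poly_degenerate_bell_Suc[OF assms(2), of n y] by (simp add: poly_sum of_nat_poly mult_ac)
    then show ?thesis
      by (simp add: poly_eq_poly_eq_iff[symmetric] fun_eq_iff)
  qed
qed

end
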